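(* Let $r\in(1,+\infty)$ and let $\mu$ be a growth rate with $\mu\succ\mathrm{s}_r$. Then, both as $\tau\to+\infty$ and as $\tau\to-\infty$, $$\lim_{\tau\to\pm\infty}\mu_\tau(t)=\begin{cases}+\infty&\text{if }t>0,\\1&\text{if }t=0,\\0&\text{if }t<0.\end{cases}$$
   Context: A growth rate is a strictly increasing differentiable function $\mu:\mathbb{R}\to\mathbb{R}^+$ with $\mu(0)=1$, $\lim_{t\to+\infty}\mu(t)=+\infty$, $\lim_{t\to-\infty}\mu(t)=0$. For $\tau\in\mathbb{R}$, its $\tau$-translation is $\mu_\tau(t)=\mu(t+\tau)/\mu(\tau)$. For $r\in(1,+\infty)$, $\mathrm{s}_r(t)=e^{\mathrm{sgn}(t)|t|^r}$ is the superexponential growth rate. For growth rates $\sigma,\mu$, $\mu\succ\sigma$ ($\mu$ weakly faster than $\sigma$) means that there is $M\ge1$ with $\frac{\sigma(t)}{\sigma(s)}\le M\frac{\mu(t)}{\mu(s)}$ for all $t\ge s$. *)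

theory Defs
  imports "HOL-Analysis.Analysis"
begin

definition growth_rate :: "(real \<Rightarrow> real) \<Rightarrow> bool" where
  "growth_rate \<mu> \<longleftrightarrow>
     (\<forall>t. \<mu> t > 0) \<and> strict_mono \<mu> \<and> (\<forall>t. \<mu> differentiable (at t)) \<and> \<mu> 0 = 1 \<and>
     filterlim \<mu> at_top at_top \<and> (\<mu> \<longlongrightarrow> 0) at_bot"

definition translation :: "(real \<Rightarrow> real) \<Rightarrow> real \<Rightarrow> real \<Rightarrow> real" where
  "translation \<mu> \<tau> t = \<mu> (t + \<tau>) / \<mu> \<tau>"

definition superexp :: "real \<Rightarrow> real \<Rightarrow> real" where
  "superexp r t = exp (sgn t * \<bar>t\<bar> powr r)"

(* weakly_faster \<mu> \<sigma>: the first argument is the faster one. Used only for growth rates,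
   so the denominators are positive. *)
definition weakly_faster :: "(real \<Rightarrow> real) \<Rightarrow> (real \<Rightarrow> real) \<Rightarrow> bool" where
  "weakly_faster \<mu> \<sigma> \<longleftrightarrow>
     (\<exists>M\<ge>1. \<forall>t s. t \<ge> s \<longrightarrow> \<sigma> t / \<sigma> s \<le> M * (\<mu> t / \<mu> s))"

end

theory Submission
  imports Defs "HOL-Real_Asymp.Real_Asymp"
begin

text \<open>
  For \<open>t > 0\<close> the increment \<open>(x + t) powr r - x powr r\<close> tends to infinity with \<open>x\<close> because
  \<open>r > 1\<close>. As the exponent of the superexponential rate is odd, its increments over intervals of
  length \<open>t\<close> escaping to \<open>-\<infinity>\<close> are of the same form, so the translations of that rate at \<open>t\<close>
  tend to infinity at both ends. A weakly faster rate inherits this up to the factor \<open>M\<close>,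
  and the case \<open>t < 0\<close> follows by taking reciprocals, since \<open>\<mu>\<^sub>\<tau>(t) \<mu>\<^bsub>\<tau>+t\<^esub>(-t) = 1\<close>.
\<close>

lemma filterlim_powr_increment_at_top:
  fixes r t :: real
  assumes "r > 1" "t > 0"
  shows "filterlim (\<lambda>x. (x + t) powr r - x powr r) at_top at_top"
  using assms by real_asymp

lemma superexp_translation_at_top:
  assumes "r > 1" "t > 0"
  shows "filterlim (\<lambda>\<tau>. translation (superexp r) \<tau> t) at_top at_top"
proof -
  have "filterlim (\<lambda>x. exp ((x + t) powr r - x powr r)) at_top at_top"
    using filterlim_compose[OF exp_at_top filterlim_powr_increment_at_top[OF assms]] .
  \<comment> \<open>For \<open>x > 0\<close> both \<open>x\<close> and \<open>x + t\<close> are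
    positive, so every sign in the exponents is 1.\<close>
  moreover have "\<forall>\<^sub>F x in at_top. exp ((x + t) powr r - x powr r) = translation (superexp r) x t"
    using eventually_gt_at_top[of 0] by eventually_elim
      (use \<open>t > 0\<close> in \<open>simp add: translation_def superexp_def exp_diff add.commute\<close>)
  ultimately show ?thesis
    by (rule filterlim_cong[OF refl refl, THEN iffD1, rotated])
qed

text \<open>The reflection \<open>x = - \<tau> - t\<close> carries the endpoints
  \<open>\<tau>\<close> and \<open>t + \<tau>\<close> to \<open>x + t\<close> and \<open>x\<close>,
  which reduces this end to increments of \<open>powr\<close> at infinity.\<close>

lemma superexp_translation_at_bot:
  assumes "r > 1" "t > 0"
  shows "filterlim (\<lambda>\<tau>. translation (superexp r) \<tau> t) at_top at_bot"
proof -
  have "filterlim (\<lambda>\<tau>::real. - \<tau> - t) at_top at_bot"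
    by real_asymp
  then have "filterlim (\<lambda>\<tau>. exp ((- \<tau> - t + t) powr r - (- \<tau> - t) powr r)) at_top at_bot"
    by (rule filterlim_compose[OF exp_at_top filterlim_compose[OF
          filterlim_powr_increment_at_top[OF assms]]])
  moreover have "\<forall>\<^sub>F \<tau> in at_bot. exp ((- \<tau> - t + t) powr r - (- \<tau> - t) powr r)
      = translation (superexp r) \<tau> t"
    \<comment> \<open>Below \<open>- t\<close> both \<open>\<tau>\<close> and
      \<open>t + \<tau>\<close> are negative, so both signs are -1.\<close>
    using eventually_gt_at_bot[of "- t"]
    by eventually_elim
      (use \<open>t > 0\<close> in \<open>simp add: translation_def superexp_def algebra_simps flip: exp_diff\<close>)
  ultimately show ?thesis
    by (rule filterlim_cong[OF refl refl, THEN iffD1, rotated])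
qed

text \<open>The comparison at the pair \<open>t + \<tau> \<ge> \<tau>\<close> has a constant
  \<open>M\<close> independent of \<open>\<tau>\<close>, and dividing by it preserves divergence.
  The filter is arbitrary so that both ends are covered.\<close>

lemma translation_at_top_if_weakly_faster:
  assumes "weakly_faster \<mu> \<sigma>" "t \<ge> 0"
    and "filterlim (\<lambda>\<tau>. translation \<sigma> \<tau> t) at_top F"
  shows "filterlim (\<lambda>\<tau>. translation \<mu> \<tau> t) at_top F"
proof -
  obtain M where "M \<ge> 1" and M: "\<And>t s. t \<ge> s \<Longrightarrow> \<sigma> t / \<sigma> s \<le> M * (\<mu> t / \<mu> s)"
    using assms(1) unfolding weakly_faster_def by blast
  have "filterlim (\<lambda>\<tau>. (1 / M) * translation \<sigma> \<tau> t) at_top F"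
    using \<open>M \<ge> 1\<close> by (intro filterlim_tendsto_pos_mult_at_top[OF tendsto_const _ assms(3)]) simp
  then show ?thesis
  proof (rule filterlim_at_top_mono)
    have "translation \<sigma> \<tau> t \<le> M * translation \<mu> \<tau> t" for \<tau>
      using M[of \<tau> "t + \<tau>"] \<open>t \<ge> 0\<close> by (simp add: translation_def)
    then have "(1 / M) * translation \<sigma> \<tau> t \<le> translation \<mu> \<tau> t" for \<tau>
      using \<open>M \<ge> 1\<close> by (simp add: pos_divide_le_eq mult.commute)
    then show "\<forall>\<^sub>F \<tau> in F. (1 / M) * translation \<sigma> \<tau> t \<le> translation \<mu> \<tau> t"
      by simp
  qed
qed

text \<open>Divergence for positive \<open>t\<close> determines the other two cases;
  \<open>shift\<close> allows the base point to move with \<open>\<tau>\<close> when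
  \<open>t < 0\<close>.\<close>

lemma translation_tendsto:
  assumes pos: "\<And>t. \<mu> t > 0"
    and lim: "\<And>t. t > 0 \<Longrightarrow> filterlim (\<lambda>\<tau>. translation \<mu> \<tau> t) at_top F"
    and shift: "\<And>c. filterlim (\<lambda>\<tau>. c + \<tau>) F F"
  shows "((\<lambda>\<tau>. ereal (translation \<mu> \<tau> t)) \<longlongrightarrow>
      (if t > 0 then \<infinity> else if t = 0 then 1 else 0)) F"
proof -
  consider "t > 0" | "t = 0" | "t < 0"
    by linarith
  then show ?thesis
  proof cases
    case 1
    then show ?thesis
      using lim by (simp add: tendsto_PInfty_eq_at_top)
  next
    case 2
    \<comment> \<open>Without this the quotient at \<open>t = 0\<close> could be the default 0
      instead of 1.\<close>
    have "\<mu> \<tau> \<noteq> 0" for \<tau>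
      using pos[of \<tau>] by simp
    with 2 show ?thesis
      by (simp add: translation_def one_ereal_def)
  next
    case 3
    have "filterlim (\<lambda>\<tau>. translation \<mu> (t + \<tau>) (- t)) at_top F"
      using filterlim_compose[OF lim shift] 3 by simp
    then have "((\<lambda>\<tau>. inverse (translation \<mu> (t + \<tau>) (- t))) \<longlongrightarrow> 0) F"
      by (rule tendsto_inverse_0_at_top)
    \<comment> \<open>Since \<open>- t + (t + \<tau>) = \<tau>\<close>, inverting just swaps the two
      values of \<open>\<mu>\<close>.\<close>
    then have "((\<lambda>\<tau>. translation \<mu> \<tau> t) \<longlongrightarrow> 0) F"
      by (simp add: translation_def)
    with 3 show ?thesis
      by (simp add: zero_ereal_def)
  qed
qed

theorem lemma3p5:
  fixes r :: real and \<mu> :: "real \<Rightarrow> real"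
  assumes "r > 1"
    and "growth_rate \<mu>"
    and "weakly_faster \<mu> (superexp r)"
  shows "\<forall>F \<in> {at_top, at_bot :: real filter}. \<forall>t :: real.
    ((\<lambda>\<tau>. ereal (translation \<mu> \<tau> t)) \<longlongrightarrow>
      (if t > 0 then \<infinity> else if t = 0 then 1 else 0)) F"
proof (intro ballI allI)
  fix F :: "real filter" and t :: real
  assume F: "F \<in> {at_top, at_bot}"
  show "((\<lambda>\<tau>. ereal (translation \<mu> \<tau> t)) \<longlongrightarrow>
      (if t > 0 then \<infinity> else if t = 0 then 1 else 0)) F"
  proof (rule translation_tendsto)
    show "\<mu> t > 0" for t
      using assms(2) by (simp add: growth_rate_def)
  next
    fix t :: real assume "t > 0"
    then have "filterlim (\<lambda>\<tau>. translation (superexp r) \<tau> t) at_top F"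
      using F superexp_translation_at_top superexp_translation_at_bot assms(1) by auto
    then show "filterlim (\<lambda>\<tau>. translation \<mu> \<tau> t) at_top F"
      using translation_at_top_if_weakly_faster[OF assms(3)] \<open>t > 0\<close> by simp
  next
    have "filterlim (\<lambda>\<tau>::real. c + \<tau>) at_top at_top" "filterlim (\<lambda>\<tau>::real. c + \<tau>) at_bot at_bot" for c
      by real_asymp+
    then show "filterlim (\<lambda>\<tau>. c + \<tau>) F F" for c
      using F by auto
  qed
qed

end
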